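(* Let $S(W,V)$ be a quasi-Lie scheme on $\mathbb{R}^n$, let $g\in\mathcal{G}(W)$ be a generalized flow, and let $V_0\subset V$ be a Lie algebra of vector fields. Then the family of quasi-Lie systems $$S_g(W,V;V_0)=\{X\in V(\mathbb{R})\ :\ g_\bigstar X\in V_0(\mathbb{R})\}$$ is a Lie family. It admits the common time-dependent superposition function $$\bar\Phi_g(t,x_{(1)},\ldots,x_{(m)},k)=g_t^{-1}\circ\Phi\left(g_t(x_{(1)}),\ldots,g_t(x_{(m)}),k\right),$$ for any time-independent superposition function $\Phi$ associated with the Lie algebra of vector fields $V_0$ by the Lie Theorem.
   Context: A time-dependent vector field on $\mathbb{R}^n$ is $X(t,x)=\sum_i X^i(t,x)\,\partial/\partial x^i$; write $X_t=X(t,\cdot)$. The same symbol denotes the system $dx^i/dt=X^i(t,x)$. $\mathfrak{X}_t(\mathbb{R}^n)$ is the set of all time-dependent vector fields on $\mathbb{R}^n$. Each $X\in\mathfrak{X}_t(\mathbb{R}^n)$ gives rise to a generalized flow $g^X:(t,x)\mapsto g^X_t(x)\in\mathbb{R}^n$, defined in a neighborhood of $\{0\}\times\mathbb{R}^n$ in $\mathbb{R}\times\mathbb{R}^n$, with $g^X_0=\mathrm{Id}$ and such that $t\mapsto g^X_t(x_0)$ is the integral curve of $X$ starting from $x_0$ at $t=0$. A generalized flow $h$ acts on $\mathfrak{X}_t(\mathbb{R}^n)$: $h_\bigstar X$ is the time-dependent vector field whose generalized flow is $g^{h_\bigstar X}_t=h_t\circ g^X_t$. For a finite-dimensional vector space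 $V$ of vector fields on $\mathbb{R}^n$, $V(\mathbb{R})$ is the set of $X\in\mathfrak{X}_t(\mathbb{R}^n)$ with $X_t\in V$ for every $t\in\mathbb{R}$. A quasi-Lie scheme $S(W,V)$ on $\mathbb{R}^n$ consists of two finite-dimensional vector spaces $W,V$ of vector fields on $\mathbb{R}^n$ such that $W$ is a linear subspace of $V$, $[W,W]\subset W$, and $[W,V]\subset V$. $\mathcal{G}(W)$ is the group of generalized flows of time-dependent vector fields in $W(\mathbb{R})$. A time-dependent vector field $X\in V(\mathbb{R})$ is a quasi-Lie system with respect to the scheme if $g_\bigstar X\in V_0(\mathbb{R})$ for some $g\in\mathcal{G}(W)$ and some Lie algebra of vector fields $V_0\subset V$. A family of systems $\{Y_\alpha\}_{\alpha\in\Lambda}$ on $\mathbb{R}^n$ admits a common time-dependent superposition rule (function) if there is a map $\Phi:\mathbb{R}\times\mathbb{R}^{n(m+1)}\to\mathbb{R}^n$, not depending on $\alpha$, such that the general solution $x(t)$ of any $Y_\alpha$ can be written, at least for sufficiently small $t$, as $x(t)=\Phi(t,x_{(1)}(t),\ldots,x_{(m)}(t);k)$, with $x_{(1)}(t),\ldots,x_{(m)}(t)$ a generic set of particular solutions of $Y_\alpha$ and $k=(k_1,\ldots,k_n)$ constants associated with each particular solution. Such a family is called a Lie family. A time-independent superposition function is one with no explicit dependence on $t$. Lie Theorem (known result): a system $X$ admits a time-independent superposition function if and only if $X\in V_0(\mathbb{R})$ for some finite-dimensional Lie algebra of vector fields $V_0$. A superposition function associated with $V_0$ is a time-independent superposition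 function $\Phi(x_{(1)},\ldots,x_{(m)},k)$ valid for all systems in $V_0(\mathbb{R})$. All objects are smooth, and maps such as $\Phi$ and the generalized flows are only required to be defined locally. *)

theory Defs
  imports "HOL-Analysis.Analysis"
begin

section \<open>Smooth maps\<close>

text \<open>
  Smoothness on an open set: all iterated directional derivatives of the Frechet derivative exist
  and are continuous.  The set \<open>S\<close> is always open below.
\<close>

fun Ck_on :: "nat \<Rightarrow> 'a::real_normed_vector set \<Rightarrow> ('a \<Rightarrow> 'b::real_normed_vector) \<Rightarrow> bool" where
  "Ck_on 0 S f \<longleftrightarrow> continuous_on S f"
| "Ck_on (Suc k) S f \<longleftrightarrow>
     (\<forall>x\<in>S. f differentiable (at x)) \<and> (\<forall>v. Ck_on k S (\<lambda>x. frechet_derivative f (at x) v))"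

definition smooth_on :: "'a::real_normed_vector set \<Rightarrow> ('a \<Rightarrow> 'b::real_normed_vector) \<Rightarrow> bool" where
  "smooth_on S f \<longleftrightarrow> (\<forall>k. Ck_on k S f)"


section \<open>Vector fields, finite-dimensional spaces and Lie algebras of vector fields\<close>

type_synonym 'n vfield = "real ^ 'n \<Rightarrow> real ^ 'n"
type_synonym 'n tdvfield = "real \<Rightarrow> real ^ 'n \<Rightarrow> real ^ 'n"

definition fd_vfield_space :: "'n::finite vfield set \<Rightarrow> bool" where
  "fd_vfield_space V \<longleftrightarrow>
     (\<exists>B. finite B \<and> (\<forall>X\<in>B. smooth_on UNIV X) \<and>
          V = {(\<lambda>x. \<Sum>X\<in>B. c X *\<^sub>R X x) | c. True})"

text \<open>In coordinates, \<open>[X,Y]\<^sup>i = \<Sum>j. X\<^sup>j \<partial>\<^sub>j Y\<^sup>i - Y\<^sup>j \<partial>\<^sub>j X\<^sup>i\<close>.\<close>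

definition lie_bracket :: "'n::finite vfield \<Rightarrow> 'n vfield \<Rightarrow> 'n vfield" where
  "lie_bracket X Y = (\<lambda>x. frechet_derivative Y (at x) (X x) - frechet_derivative X (at x) (Y x))"

definition lie_algebra :: "'n::finite vfield set \<Rightarrow> bool" where
  "lie_algebra L \<longleftrightarrow> fd_vfield_space L \<and> (\<forall>X\<in>L. \<forall>Y\<in>L. lie_bracket X Y \<in> L)"

definition quasi_lie_scheme :: "'n::finite vfield set \<Rightarrow> 'n vfield set \<Rightarrow> bool" where
  "quasi_lie_scheme W V \<longleftrightarrow>
     fd_vfield_space W \<and> fd_vfield_space V \<and> W \<subseteq> V \<and>
     (\<forall>X\<in>W. \<forall>Y\<in>W. lie_bracket X Y \<in> W) \<and>
     (\<forall>X\<in>W. \<forall>Y\<in>V. lie_bracket X Y \<in> V)"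


section \<open>Time-dependent vector fields and generalized flows\<close>

definition td_vector_field :: "'n::finite tdvfield \<Rightarrow> bool" where
  "td_vector_field X \<longleftrightarrow> smooth_on UNIV (\<lambda>(t, x). X t x)"

text \<open>The set \<open>V(\<real>)\<close>.\<close>

definition td_fields :: "'n::finite vfield set \<Rightarrow> 'n tdvfield set" where
  "td_fields V = {X. td_vector_field X \<and> (\<forall>t. X t \<in> V)}"

definition integral_curve :: "'n::finite tdvfield \<Rightarrow> real set \<Rightarrow> (real \<Rightarrow> real ^ 'n) \<Rightarrow> bool" where
  "integral_curve X I \<gamma> \<longleftrightarrow>
     open I \<and> is_interval I \<and> 0 \<in> I \<and> (\<forall>t\<in>I. (\<gamma> has_vector_derivative X t (\<gamma> t)) (at t))"

text \<open>
  A generalized flow is a map \<open>g\<close> together with its domain \<open>D\<close>; values of \<open>g\<close> outside \<open>D\<close> are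
  irrelevant.  Since every slice \<open>{t. (t, x) \<in> D}\<close> is an interval around \<open>0\<close>, the open set \<open>D\<close> is
  a neighbourhood of \<open>{0} \<times> \<real>\<^sup>n\<close>.
\<close>

definition generalized_flow ::
    "'n::finite tdvfield \<Rightarrow> (real \<times> (real ^ 'n)) set \<Rightarrow> (real \<Rightarrow> real ^ 'n \<Rightarrow> real ^ 'n) \<Rightarrow> bool" where
  "generalized_flow X D g \<longleftrightarrow>
     open D \<and> smooth_on D (\<lambda>(t, x). g t x) \<and>
     (\<forall>x. g 0 x = x \<and> integral_curve X {t. (t, x) \<in> D} (\<lambda>t. g t x))"

definition maximal_flow ::
    "'n::finite tdvfield \<Rightarrow> (real \<times> (real ^ 'n)) set \<Rightarrow> (real \<Rightarrow> real ^ 'n \<Rightarrow> real ^ 'n) \<Rightarrow> bool" where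
  "maximal_flow X E f \<longleftrightarrow>
     generalized_flow X E f \<and>
     (\<forall>I \<gamma>. integral_curve X I \<gamma> \<longrightarrow> (\<forall>t\<in>I. (t, \<gamma> 0) \<in> E \<and> f t (\<gamma> 0) = \<gamma> t))"

text \<open>The elements of \<open>\<G>(W)\<close>, each with its domain.\<close>

definition flow_group ::
    "'n::finite vfield set \<Rightarrow> ((real \<times> (real ^ 'n)) set \<times> (real \<Rightarrow> real ^ 'n \<Rightarrow> real ^ 'n)) set" where
  "flow_group W = {(D, g). \<exists>Y\<in>td_fields W. generalized_flow Y D g}"

text \<open>
  Domain of \<open>(t, x) \<mapsto> h\<^sub>t (f\<^sub>t x)\<close>, where \<open>f\<close> lives on \<open>E\<close> and \<open>h\<close> on \<open>D\<close>: the points reached from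
  time \<open>0\<close> without leaving the set where the composition makes sense.
\<close>

definition comp_dom ::
    "(real \<times> (real ^ 'n::finite)) set \<Rightarrow> (real \<times> (real ^ 'n)) set \<Rightarrow> (real \<Rightarrow> real ^ 'n \<Rightarrow> real ^ 'n)
      \<Rightarrow> (real \<times> (real ^ 'n)) set" where
  "comp_dom D E f = {(t, x). \<forall>s\<in>closed_segment 0 t. (s, x) \<in> E \<and> (s, f s x) \<in> D}"

text \<open>
  \<open>is_action D h X Z\<close>: the field \<open>Z\<close> is \<open>h\<^sub>\<bigstar> X\<close>, that is, \<open>h\<^sub>t \<circ> g\<^sup>X\<^sub>t\<close> is a generalized flow of \<open>Z\<close>,
  where \<open>g\<^sup>X\<close> is the (maximal) generalized flow of \<open>X\<close>.  This is a relation because, when the flows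
  are incomplete, the composition determines \<open>Z\<close> only on the points that it reaches.  When
  \<open>h\<close> and \<open>g\<^sup>X\<close> are complete, the composition is defined everywhere and \<open>Z\<close> is unique.
\<close>

definition is_action ::
    "(real \<times> (real ^ 'n::finite)) set \<Rightarrow> (real \<Rightarrow> real ^ 'n \<Rightarrow> real ^ 'n)
      \<Rightarrow> 'n tdvfield \<Rightarrow> 'n tdvfield \<Rightarrow> bool" where
  "is_action D h X Z \<longleftrightarrow>
     td_vector_field Z \<and>
     (\<exists>E f. maximal_flow X E f \<and> generalized_flow Z (comp_dom D E f) (\<lambda>t x. h t (f t x)))"

text \<open>The family \<open>S\<^sub>g(W,V;V\<^sub>0)\<close>, which depends on \<open>W\<close> only through \<open>g \<in> \<G>(W)\<close>.\<close>

definition scheme_family ::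
    "'n::finite vfield set \<Rightarrow> 'n vfield set \<Rightarrow> (real \<times> (real ^ 'n)) set
      \<Rightarrow> (real \<Rightarrow> real ^ 'n \<Rightarrow> real ^ 'n) \<Rightarrow> 'n tdvfield set" where
  "scheme_family V V0 D g = {X \<in> td_fields V. \<exists>Z\<in>td_fields V0. is_action D g X Z}"


section \<open>Superposition functions\<close>

text \<open>
  The number \<open>m\<close> of particular solutions is existentially quantified, so \<open>(\<real>\<^sup>n)\<^sup>m\<close> cannot be a type
  depending on \<open>m\<close>.  It is represented by the subspace of those sequences of the normed space
  \<open>nat \<Rightarrow>\<^sub>C \<real>\<^sup>n\<close> of bounded sequences that vanish from index \<open>m\<close> on (indices start at \<open>0\<close>).
  Open sets and smooth maps below live on the whole sequence space but are only evaluated on this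
  subspace; precomposing with the projection onto it shows that every open set, resp. smooth map,
  of finitely many variables arises in this way.
\<close>

type_synonym 'n seqs = "nat \<Rightarrow>\<^sub>C (real ^ 'n)"

definition tuple :: "nat \<Rightarrow> (nat \<Rightarrow> real ^ 'n::finite) \<Rightarrow> 'n seqs" where
  "tuple m x = Bcontfun (\<lambda>a. if a < m then x a else 0)"

lemma apply_tuple: "apply_bcontfun (tuple m x) a = (if a < m then x a else 0)"
proof -
  have "range (\<lambda>a. if a < m then x a else 0) \<subseteq> insert 0 (x ` {..<m})"
    by auto
  then have "bounded (range (\<lambda>a. if a < m then x a else 0))"
    by (meson finite_imp_bounded finite_imageI finite_insert finite_lessThan finite_subset)
  then have "(\<lambda>a. if a < m then x a else 0) \<in> bcontfun"
    by (simp add: bcontfun_def)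
  then show ?thesis
    by (simp add: tuple_def Bcontfun_inverse)
qed

text \<open>
  \<open>\<Phi>\<close>, smooth on the open set \<open>U\<close>, is a common time-dependent superposition function for the family
  \<open>F\<close>, with \<open>m\<close> particular solutions.  Generic means that the initial conditions of the \<open>m\<close>
  particular solutions and of the solution to be expressed form a configuration in the open set
  \<open>N\<close>.  Every initial condition \<open>x0\<close> occurs, so that every solution is expressed through a nonempty
  open set of tuples of particular solutions.  (\<open>N\<close> cannot be required to be dense: for the span of a
  single nonzero compactly supported field no superposition function would exist.)  The last two clauses
  say that \<open>t \<mapsto> \<Phi>(t, x\<^sub>1(t), \<dots>, x\<^sub>m(t), k)\<close> is the general solution: each solution has this form
  for some constant \<open>k\<close>, and each \<open>k\<close> gives a solution, both for small \<open>t\<close>.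
\<close>

definition superposition_function ::
    "'n::finite tdvfield set \<Rightarrow> nat \<Rightarrow> ('n seqs \<times> (real ^ 'n)) set
      \<Rightarrow> (real \<times> 'n seqs \<times> (real ^ 'n)) set \<Rightarrow> (real \<times> 'n seqs \<times> (real ^ 'n) \<Rightarrow> real ^ 'n) \<Rightarrow> bool" where
  "superposition_function F m N U \<Phi> \<longleftrightarrow>
     open U \<and> smooth_on U \<Phi> \<and>
     open N \<and> (\<forall>x0. \<exists>p. (tuple m p, x0) \<in> N) \<and>
     (\<forall>Y\<in>F. \<forall>x I. (\<forall>a<m. integral_curve Y (I a) (x a)) \<longrightarrow>
        (\<forall>J y. integral_curve Y J y \<and> (tuple m (\<lambda>a. x a 0), y 0) \<in> N \<longrightarrow>
           (\<exists>k. \<exists>\<epsilon>>0. \<forall>t. \<bar>t\<bar> < \<epsilon> \<longrightarrow>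
              (t, tuple m (\<lambda>a. x a t), k) \<in> U \<and> y t = \<Phi> (t, tuple m (\<lambda>a. x a t), k))) \<and>
        (\<forall>k. (0, tuple m (\<lambda>a. x a 0), k) \<in> U \<and>
             (tuple m (\<lambda>a. x a 0), \<Phi> (0, tuple m (\<lambda>a. x a 0), k)) \<in> N \<longrightarrow>
           (\<exists>\<epsilon>>0. (\<forall>t. \<bar>t\<bar> < \<epsilon> \<longrightarrow> (t, tuple m (\<lambda>a. x a t), k) \<in> U) \<and>
              integral_curve Y {-\<epsilon><..<\<epsilon>} (\<lambda>t. \<Phi> (t, tuple m (\<lambda>a. x a t), k)))))"

definition lie_family :: "'n::finite tdvfield set \<Rightarrow> bool" where
  "lie_family F \<longleftrightarrow> (\<exists>m N U \<Phi>. superposition_function F m N U \<Phi>)"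

text \<open>Time-independent superposition functions valid for all systems in \<open>L(\<real>)\<close>.\<close>

definition associated_superposition_function ::
    "'n::finite vfield set \<Rightarrow> nat \<Rightarrow> ('n seqs \<times> (real ^ 'n)) set
      \<Rightarrow> ('n seqs \<times> (real ^ 'n)) set \<Rightarrow> ('n seqs \<times> (real ^ 'n) \<Rightarrow> real ^ 'n) \<Rightarrow> bool" where
  "associated_superposition_function L m N U \<Phi> \<longleftrightarrow>
     superposition_function (td_fields L) m N (UNIV \<times> U) (\<lambda>(t, p, k). \<Phi> (p, k))"

text \<open>The existence part of the Lie Theorem on \<open>\<real>\<^sup>n\<close>.\<close>

definition Lie_theorem :: "'n::finite itself \<Rightarrow> bool" where
  "Lie_theorem _ \<longleftrightarrow>
     (\<forall>L :: 'n vfield set. lie_algebra L \<longrightarrow>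
        (\<exists>m N U \<Phi>. associated_superposition_function L m N U \<Phi>))"

text \<open>
  The function \<open>(t, x\<^sub>1, \<dots>, x\<^sub>m, k) \<mapsto> g\<^sub>t\<^sup>-\<^sup>1 (\<Phi>(g\<^sub>t(x\<^sub>1), \<dots>, g\<^sub>t(x\<^sub>m), k))\<close> and its natural domain.
\<close>

definition transformed_superposition ::
    "nat \<Rightarrow> (real \<times> (real ^ 'n::finite)) set \<Rightarrow> (real \<Rightarrow> real ^ 'n \<Rightarrow> real ^ 'n)
      \<Rightarrow> ('n seqs \<times> (real ^ 'n) \<Rightarrow> real ^ 'n) \<Rightarrow> (real \<times> 'n seqs \<times> (real ^ 'n) \<Rightarrow> real ^ 'n)" where
  "transformed_superposition m D g \<Phi> =
     (\<lambda>(t, p, k). inv_into {x. (t, x) \<in> D} (g t) (\<Phi> (tuple m (\<lambda>a. g t (apply_bcontfun p a)), k)))"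

definition transformed_domain ::
    "nat \<Rightarrow> (real \<times> (real ^ 'n::finite)) set \<Rightarrow> (real \<Rightarrow> real ^ 'n \<Rightarrow> real ^ 'n)
      \<Rightarrow> ('n seqs \<times> (real ^ 'n)) set \<Rightarrow> ('n seqs \<times> (real ^ 'n) \<Rightarrow> real ^ 'n)
      \<Rightarrow> (real \<times> 'n seqs \<times> (real ^ 'n)) set" where
  "transformed_domain m D g U \<Phi> =
     {(t, p, k). (\<forall>a<m. (t, apply_bcontfun p a) \<in> D) \<and>
        (tuple m (\<lambda>a. g t (apply_bcontfun p a)), k) \<in> U \<and>
        \<Phi> (tuple m (\<lambda>a. g t (apply_bcontfun p a)), k) \<in> g t ` {x. (t, x) \<in> D}}"

end

theory Submission
  imports Defs
begin

text \<open>
  Write \<open>Z = g\<^sub>\<bigstar> X\<close>.  By definition of the action, \<open>g\<^sub>t\<close> maps solutions of \<open>X\<close> to solutions of \<open>Z\<close>, and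
  \<open>Z\<close> lies in \<open>V\<^sub>0(\<real>)\<close>, where \<open>\<Phi>\<close> is a superposition function.  If \<open>y, x\<^sub>1, \<dots>, x\<^sub>m\<close> are solutions of
  \<open>X\<close>, then \<open>g\<^sub>t(y) = \<Phi>(g\<^sub>t(x\<^sub>1), \<dots>, g\<^sub>t(x\<^sub>m), k)\<close> for some constant \<open>k\<close>, and applying \<open>g\<^sub>t\<^sup>-\<^sup>1\<close> gives the
  formula.  Conversely, for given \<open>k\<close> the right-hand side is a solution of \<open>Z\<close>; the image under \<open>g\<close>
  of the solution of \<open>X\<close> with the same initial value is another one, and the two agree by uniqueness.
  Neither \<open>\<Phi>\<close> nor \<open>g\<close> depends on \<open>X\<close>, so the superposition function is common to the whole family
  (\<open>transformed_superposition_function\<close>).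

  What takes work is that the transformed function is smooth on an open domain, that is, that
  \<open>(t, y) \<mapsto> g\<^sub>t\<^sup>-\<^sup>1 y\<close> is (\<open>generalized_flow_inverse\<close>).  A two-sided Gronwall estimate
  (\<open>ode_distance_bound\<close>) shows both that \<open>g\<^sub>t\<close> is injective and that it does not contract distances
  too much, so that its derivative is injective.  Invariance of domain then yields a continuous
  inverse with open domain, and Cramer's rule raises its order of differentiability step by step.
\<close>

section \<open>Calculus of functions of class \<open>C\<^sup>k\<close>\<close>

text \<open>
  Derivatives at points of an open set only depend on the values in it.  All the rules below work
  with derivatives that are known on \<open>S\<close> alone, while \<^const>\<open>Ck_on\<close> speaks of
  \<^const>\<open>frechet_derivative\<close>, and this lemma passes from one to the other.
\<close>

lemma Ck_on_cong:
  assumes "open S" "Ck_on k S f" "\<And>x. x \<in> S \<Longrightarrow> f x = g x"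
  shows "Ck_on k S g"
  using assms(2,3)
proof (induction k arbitrary: f g)
  case 0
  then show ?case
    using continuous_on_eq by (auto simp del: split_paired_All)
next
  case (Suc k)
  have der: "(g has_derivative frechet_derivative f (at x)) (at x)" if "x \<in> S" for x
  proof (rule has_derivative_transform_within_open[OF _ assms(1) that])
    show "(f has_derivative frechet_derivative f (at x)) (at x)"
      using Suc.prems(1) that by (simp add: frechet_derivative_works[symmetric])
  qed (simp add: Suc.prems(2))
  have eq: "frechet_derivative f (at x) = frechet_derivative g (at x)" if "x \<in> S" for x
    using frechet_derivative_at[OF der[OF that]] .
  have "Ck_on k S (\<lambda>x. frechet_derivative g (at x) v)" for v
    by (rule Suc.IH[of "\<lambda>x. frechet_derivative f (at x) v"]) (use Suc.prems eq in auto)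
  then show ?case
    using der by (auto simp: differentiable_def)
qed

lemma Ck_on_SucI:
  assumes "open S" "\<And>x. x \<in> S \<Longrightarrow> (f has_derivative f' x) (at x)"
    and "\<And>v. Ck_on k S (\<lambda>x. f' x v)"
  shows "Ck_on (Suc k) S f"
proof -
  have "Ck_on k S (\<lambda>x. frechet_derivative f (at x) v)" for v
    by (rule Ck_on_cong[OF assms(1) assms(3)[of v]])
      (use frechet_derivative_at[OF assms(2)] in auto)
  then show ?thesis
    using assms(2) by (auto simp: differentiable_def)
qed

lemma Ck_on_Suc_has_derivative:
  "Ck_on (Suc k) S f \<Longrightarrow> x \<in> S \<Longrightarrow> (f has_derivative frechet_derivative f (at x)) (at x)"
  by (simp add: frechet_derivative_works[symmetric])

lemma Ck_on_SucD: "Ck_on (Suc k) S f \<Longrightarrow> Ck_on k S f"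
proof (induction k arbitrary: f)
  case 0
  then show ?case
    by (auto intro!: differentiable_imp_continuous_on
        simp: differentiable_on_def differentiable_at_withinI)
next
  case (Suc k)
  then show ?case by (metis Ck_on.simps(2))
qed

lemma Ck_on_continuous: "Ck_on k S f \<Longrightarrow> continuous_on S f"
  by (induction k) (auto dest: Ck_on_SucD simp del: Ck_on.simps(2))

lemma Ck_on_subset: "Ck_on k S f \<Longrightarrow> T \<subseteq> S \<Longrightarrow> Ck_on k T f"
  by (induction k arbitrary: f) (auto intro: continuous_on_subset)

lemma Ck_on_const:
  assumes "open S" shows "Ck_on k S (\<lambda>x. c)"
proof (induction k arbitrary: c)
  case (Suc k)
  then show ?case by (intro Ck_on_SucI[where f' = "\<lambda>x v. 0"] assms) auto
qed simp

lemma Ck_on_bounded_linear: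
  assumes "open S" "bounded_linear L" shows "Ck_on k S L"
proof (cases k)
  case 0
  then show ?thesis by (simp add: assms linear_continuous_on)
next
  case (Suc j)
  then show ?thesis
    by (simp only:) (intro Ck_on_SucI[where f' = "\<lambda>x. L"] assms Ck_on_const
        bounded_linear_imp_has_derivative)
qed

lemma Ck_on_add:
  assumes "open S" shows "Ck_on k S f \<Longrightarrow> Ck_on k S g \<Longrightarrow> Ck_on k S (\<lambda>x. f x + g x)"
proof (induction k arbitrary: f g)
  case 0
  then show ?case by (auto intro: continuous_intros)
next
  case (Suc k)
  show ?case
    by (rule Ck_on_SucI[OF assms has_derivative_add[OF Suc.prems[THEN Ck_on_Suc_has_derivative]]])
      (use Suc in auto)
qed

lemma Ck_on_sum:
  assumes "open S" "finite I" "\<And>i. i \<in> I \<Longrightarrow> Ck_on k S (f i)"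
  shows "Ck_on k S (\<lambda>x. \<Sum>i\<in>I. f i x)"
  using assms(2,3)
  by (induction I rule: finite_induct) (auto intro: Ck_on_const Ck_on_add assms(1))

lemma Ck_on_scaleR:
  assumes "open S"
  shows "Ck_on k S f \<Longrightarrow> Ck_on k S g \<Longrightarrow> Ck_on k S (\<lambda>x. f x *\<^sub>R g x)"
proof (induction k arbitrary: f g)
  case 0
  then show ?case by (auto intro: continuous_intros)
next
  case (Suc k)
  show ?case
    by (rule Ck_on_SucI[OF assms has_derivative_scaleR[OF Suc.prems[THEN Ck_on_Suc_has_derivative]]])
      (use Suc.IH Suc.prems Suc.prems[THEN Ck_on_SucD] in \<open>auto intro!: Ck_on_add assms\<close>)
qed

lemma Ck_on_mult:
  fixes f g :: "_ \<Rightarrow> real"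
  shows "open S \<Longrightarrow> Ck_on k S f \<Longrightarrow> Ck_on k S g \<Longrightarrow> Ck_on k S (\<lambda>x. f x * g x)"
  using Ck_on_scaleR[of S k f g] by simp

lemma Ck_on_prod:
  fixes f :: "_ \<Rightarrow> _ \<Rightarrow> real"
  assumes "open S" "finite I" "\<And>i. i \<in> I \<Longrightarrow> Ck_on k S (f i)"
  shows "Ck_on k S (\<lambda>x. \<Prod>i\<in>I. f i x)"
  using assms(2,3)
  by (induction I rule: finite_induct) (auto intro: Ck_on_const Ck_on_mult assms(1))

lemma Ck_on_linear_compose:
  assumes "open S" "bounded_linear L"
  shows "Ck_on k S f \<Longrightarrow> Ck_on k S (\<lambda>x. L (f x))"
proof (induction k arbitrary: f)
  case 0
  then show ?case
    using linear_continuous_on[OF assms(2)] by (auto intro: continuous_on_compose2)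
next
  case (Suc k)
  show ?case
    by (rule Ck_on_SucI[OF assms(1)
            bounded_linear.has_derivative[OF assms(2) Ck_on_Suc_has_derivative[OF Suc.prems]]])
      (use Suc in auto)
qed

lemma Ck_on_inverse:
  fixes f :: "_ \<Rightarrow> real"
  assumes "open S" "\<And>x. x \<in> S \<Longrightarrow> f x \<noteq> 0"
  shows "Ck_on k S f \<Longrightarrow> Ck_on k S (\<lambda>x. inverse (f x))"
proof (induction k)
  case 0
  then show ?case using assms by (auto intro: continuous_intros)
next
  case (Suc k)
  show ?case
    by (rule Ck_on_SucI[OF assms(1)
            Deriv.has_derivative_inverse[OF assms(2) Ck_on_Suc_has_derivative[OF Suc.prems]]])
      (use Suc.IH[OF Ck_on_SucD[OF Suc.prems]] Suc.prems in
        \<open>auto intro!: Ck_on_linear_compose[OF assms(1) bounded_linear_minus[OF bounded_linear_ident]]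
          Ck_on_mult assms\<close>)
qed

lemma Ck_on_inner_const:
  "open S \<Longrightarrow> Ck_on k S f \<Longrightarrow> Ck_on k S (\<lambda>x. f x \<bullet> b)"
  by (rule Ck_on_linear_compose[OF _ bounded_linear_inner_left])

lemma Ck_on_componentwise:
  fixes f :: "'a::real_normed_vector \<Rightarrow> 'b::euclidean_space"
  assumes "open S" "\<And>b. b \<in> Basis \<Longrightarrow> Ck_on k S (\<lambda>x. f x \<bullet> b)"
  shows "Ck_on k S f"
proof -
  have "Ck_on k S (\<lambda>x. \<Sum>b\<in>Basis. (f x \<bullet> b) *\<^sub>R b)"
    using assms by (intro Ck_on_sum Ck_on_scaleR Ck_on_const) auto
  then show ?thesis by (simp add: euclidean_representation)
qed

text \<open>
  The chain rule needs a finite-dimensional intermediate space: smoothness only controls one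
  directional derivative at a time, so the derivative \<open>f' (h x) (h' x v)\<close> of a composition can be
  differentiated again only after \<open>h' x v\<close> has been expanded along fixed vectors \<open>e i\<close>.  The inner
  map is therefore required to take values in the span of finitely many vectors, but the
  space around that span may be infinite-dimensional, as the space of sequences is.
\<close>

lemma Ck_on_compose_span:
  assumes "open S" "finite I"
    and "\<And>x. x \<in> S \<Longrightarrow> h x = (\<Sum>i\<in>I. c i x *\<^sub>R e i)" "\<And>x. x \<in> S \<Longrightarrow> h x \<in> T"
  shows "Ck_on k T f \<Longrightarrow> (\<And>i. i \<in> I \<Longrightarrow> Ck_on k S (c i)) \<Longrightarrow> Ck_on k S (\<lambda>x. f (h x))"
proof (induction k arbitrary: f)
  case 0
  have "continuous_on S (\<lambda>x. \<Sum>i\<in>I. c i x *\<^sub>R e i)"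
    using 0 by (auto intro!: continuous_intros)
  then have "continuous_on S h"
    by (rule continuous_on_eq) (simp add: assms)
  then show ?case
    using 0 assms(4) by (auto intro: continuous_on_compose2)
next
  case (Suc k)
  let ?f' = "\<lambda>y. frechet_derivative f (at y)"
  let ?c' = "\<lambda>i x. frechet_derivative (c i) (at x)"
  have h': "(h has_derivative (\<lambda>v. \<Sum>i\<in>I. ?c' i x v *\<^sub>R e i)) (at x)" if "x \<in> S" for x
  proof -
    have "((\<lambda>x. \<Sum>i\<in>I. c i x *\<^sub>R e i) has_derivative (\<lambda>v. \<Sum>i\<in>I. ?c' i x v *\<^sub>R e i)) (at x)"
      using Ck_on_Suc_has_derivative[OF Suc.prems(2) that]
      by (intro has_derivative_sum has_derivative_scaleR_left)
    then show ?thesis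
      by (rule has_derivative_transform_within_open[OF _ assms(1) that]) (simp add: assms(3))
  qed
  have "((\<lambda>x. f (h x)) has_derivative (\<lambda>v. \<Sum>i\<in>I. ?c' i x v *\<^sub>R ?f' (h x) (e i))) (at x)"
    if "x \<in> S" for x
  proof -
    have f': "(f has_derivative ?f' (h x)) (at (h x))"
      using Suc.prems(1) assms(4)[OF that] by (rule Ck_on_Suc_has_derivative)
    interpret bounded_linear "?f' (h x)"
      using f' by (rule has_derivative_bounded_linear)
    show ?thesis
      using has_derivative_compose[OF h'[OF that] f'] by (simp add: sum scaleR)
  qed
  then show ?case
  proof (rule Ck_on_SucI[OF assms(1)])
    show "Ck_on k S (\<lambda>x. \<Sum>i\<in>I. ?c' i x v *\<^sub>R ?f' (h x) (e i))" for v
      using Suc.prems(1) Suc.prems(2) Suc.prems(2)[THEN Ck_on_SucD]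
      by (intro Ck_on_sum Ck_on_scaleR assms(1,2) Suc.IH) auto
  qed
qed

lemma Ck_on_compose:
  fixes h :: "'a::real_normed_vector \<Rightarrow> 'b::euclidean_space"
  assumes "open S" "Ck_on k T f" "Ck_on k S h" "\<And>x. x \<in> S \<Longrightarrow> h x \<in> T"
  shows "Ck_on k S (\<lambda>x. f (h x))"
proof (rule Ck_on_compose_span[OF assms(1) finite_Basis _ assms(4) assms(2)])
  show "h x = (\<Sum>b\<in>Basis. (h x \<bullet> b) *\<^sub>R b)" for x
    by (simp add: euclidean_representation)
  show "Ck_on k S (\<lambda>x. h x \<bullet> b)" for b
    by (rule Ck_on_inner_const[OF assms(1,3)])
qed

text \<open>
  By Cramer's rule the entries of the solution of a regular linear system are rational functions
  of the coefficients and of the right-hand side.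
\<close>

lemma Ck_on_linear_solve:
  fixes A :: "'a::real_normed_vector \<Rightarrow> real ^ 'n::finite ^ 'n"
  assumes "open S" "\<And>i j. Ck_on k S (\<lambda>x. A x $ i $ j)" "Ck_on k S b"
    and "\<And>x. x \<in> S \<Longrightarrow> det (A x) \<noteq> 0" "\<And>x. x \<in> S \<Longrightarrow> A x *v w x = b x"
  shows "Ck_on k S w"
proof -
  have det: "Ck_on k S (\<lambda>x. det (M x))"
    if "\<And>i j. Ck_on k S (\<lambda>x. M x $ i $ j)" for M :: "'a \<Rightarrow> real ^ 'n ^ 'n"
    unfolding det_def using that
    by (intro Ck_on_sum Ck_on_mult Ck_on_prod Ck_on_const assms(1))
      (auto simp: finite_permutations)
  have b: "Ck_on k S (\<lambda>x. b x $ i)" for i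
    using assms(1,3) by (auto intro: Ck_on_linear_compose bounded_linear_vec_nth)
  define N where "N = (\<lambda>x l. (\<chi> i j. if j = l then b x $ i else A x $ i $ j) :: real ^ 'n ^ 'n)"
  have "Ck_on k S (\<lambda>x. N x l $ i $ j)" for l i j
    by (cases "j = l") (simp_all add: N_def assms(2) b)
  then have "Ck_on k S (\<lambda>x. det (N x l) * inverse (det (A x)))" for l
    by (intro Ck_on_mult Ck_on_inverse det assms)
  then have "Ck_on k S (\<lambda>x. w x $ l)" for l
  proof (rule Ck_on_cong[OF assms(1)])
    fix x assume "x \<in> S"
    then have "w x = (\<chi> l. det (N x l) / det (A x))"
      using assms(4,5) unfolding N_def by (subst cramer[symmetric]) auto
    then show "det (N x l) * inverse (det (A x)) = w x $ l"
      by (simp add: divide_inverse)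
  qed
  then show ?thesis
    by (auto intro!: Ck_on_componentwise[OF assms(1), of k w] simp: Basis_vec_def inner_axis)
qed

lemma Ck_on_Pair:
  assumes "open S" "Ck_on k S f" "Ck_on k S g"
  shows "Ck_on k S (\<lambda>x. (f x, g x))"
proof -
  have "Ck_on k S (\<lambda>x. (f x, 0))"
    by (intro Ck_on_linear_compose[OF assms(1) _ assms(2), where L = "\<lambda>y. (y, 0)"]
        bounded_linear_Pair bounded_linear_ident bounded_linear_zero)
  moreover have "Ck_on k S (\<lambda>x. (0, g x))"
    by (intro Ck_on_linear_compose[OF assms(1) _ assms(3), where L = "\<lambda>y. (0, y)"]
        bounded_linear_Pair bounded_linear_ident bounded_linear_zero)
  ultimately have "Ck_on k S (\<lambda>x. (f x, 0) + (0, g x))"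
    by (intro Ck_on_add assms(1))
  then show ?thesis by simp
qed


section \<open>Growth estimates and uniqueness for integral curves\<close>

text \<open>
  The partial derivative in \<open>x\<close> is continuous, hence bounded on the compact set in question, and
  the ball is convex, so that the mean value inequality applies.
\<close>

lemma td_vector_field_Lipschitz:
  fixes Y :: "'n::finite tdvfield"
  assumes "td_vector_field Y" "compact T"
  obtains L where "L \<ge> 0"
    "\<And>t x y. t \<in> T \<Longrightarrow> norm x \<le> R \<Longrightarrow> norm y \<le> R \<Longrightarrow> norm (Y t x - Y t y) \<le> L * norm (x - y)"
proof -
  define F where "F = (\<lambda>(t, x). Y t x)"
  define F' where "F' = (\<lambda>z. frechet_derivative F (at z))"
  have C1: "Ck_on (Suc 0) UNIV F"
    using assms(1) unfolding td_vector_field_def smooth_on_def F_def by blast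
  have F': "(F has_derivative F' z) (at z)" for z
    unfolding F'_def by (rule Ck_on_Suc_has_derivative[OF C1]) simp
  \<comment> \<open>A bound for the operator norm of the derivative in \<open>x\<close> that is visibly continuous in \<open>z\<close>.\<close>
  define B where "B = (\<lambda>z. \<Sum>b\<in>Basis. norm (F' z (0, b)))"
  have "continuous_on UNIV (\<lambda>z. F' z v)" for v
    using C1 unfolding F'_def Ck_on.simps by blast
  then have "continuous_on (T \<times> cball 0 R) B"
    unfolding B_def by (intro continuous_intros) (auto intro: continuous_on_subset)
  then have "bounded (B ` (T \<times> cball 0 R))"
    using assms(2) by (intro compact_imp_bounded compact_continuous_image compact_Times) auto
  then obtain L where L: "L > 0" "\<And>z. z \<in> T \<times> cball 0 R \<Longrightarrow> \<bar>B z\<bar> \<le> L"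
    unfolding bounded_pos by auto
  have "norm (Y t x - Y t y) \<le> L * norm (x - y)"
    if "t \<in> T" "norm x \<le> R" "norm y \<le> R" for t x y
  proof (rule differentiable_bound[of "cball 0 R"])
    fix z :: "real ^ 'n" assume z: "z \<in> cball 0 R"
    have "((\<lambda>x. F (t, x)) has_derivative (\<lambda>v. F' (t, z) (0, v))) (at z)"
      by (rule has_derivative_compose[OF _ F']) (auto intro!: derivative_eq_intros)
    then show "(Y t has_derivative (\<lambda>v. F' (t, z) (0, v))) (at z within cball 0 R)"
      by (simp add: F_def has_derivative_at_withinI)
    interpret bounded_linear "F' (t, z)"
      using F' by (rule has_derivative_bounded_linear)
    show "onorm (\<lambda>v. F' (t, z) (0, v)) \<le> L"
    proof (rule onorm_bound)
      fix v :: "real ^ 'n"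
      have "F' (t, z) (0, v) = F' (t, z) (\<Sum>b\<in>Basis. (v \<bullet> b) *\<^sub>R (0, b))"
        by (rule arg_cong[of _ _ "F' (t, z)"])
          (simp add: prod_eq_iff fst_sum snd_sum euclidean_representation)
      also have "norm \<dots> \<le> (\<Sum>b\<in>Basis. norm v * norm (F' (t, z) (0, b)))"
        unfolding sum scaleR
        by (intro order_trans[OF norm_sum] sum_mono) (auto intro!: mult_right_mono Basis_le_norm)
      also have "\<dots> = norm v * B (t, z)"
        by (simp add: B_def sum_distrib_left)
      also have "\<dots> \<le> L * norm v"
        using L(2)[of "(t, z)"] z that(1)
        by (subst mult.commute) (intro mult_right_mono, auto)
      finally show "norm (F' (t, z) (0, v)) \<le> L * norm v" .
    qed (use L in simp)
  qed (use that in auto)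
  with L(1) show ?thesis
    by (intro that[of L]) auto
qed

text \<open>
  Gronwall's estimate, for both orders of \<open>s\<close> and \<open>t\<close>.  Read from \<open>t\<close> to \<open>s\<close> it gives
  uniqueness; read with \<open>s = 0\<close> it says that the map \<open>g\<^sub>t\<close> cannot contract
  distances by more than a fixed factor.
\<close>

lemma ode_distance_bound:
  fixes u1 u2 :: "real \<Rightarrow> real ^ 'n::finite"
  assumes "\<And>r. r \<in> closed_segment s t \<Longrightarrow> (u1 has_vector_derivative Y r (u1 r)) (at r)"
    and "\<And>r. r \<in> closed_segment s t \<Longrightarrow> (u2 has_vector_derivative Y r (u2 r)) (at r)"
    and lip: "\<And>r. r \<in> closed_segment s t \<Longrightarrow>
      norm (Y r (u1 r) - Y r (u2 r)) \<le> L * norm (u1 r - u2 r)"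
  shows "norm (u1 s - u2 s) \<le> exp (L * \<bar>t - s\<bar>) * norm (u1 t - u2 t)"
proof -
  define d where "d = (\<lambda>r. u1 r - u2 r)"
  define d' where "d' = (\<lambda>r. Y r (u1 r) - Y r (u2 r))"
  \<comment> \<open>With \<open>c = L\<close> the weight makes \<open>\<phi> c\<close> nondecreasing, with \<open>c = - L\<close> nonincreasing.\<close>
  define \<phi> where "\<phi> = (\<lambda>c r. exp (2 * c * r) * (d r \<bullet> d r))"
  have d: "(d has_vector_derivative d' r) (at r)" if "r \<in> closed_segment s t" for r
    unfolding d_def d'_def by (intro has_vector_derivative_diff assms that)
  have \<phi>: "(\<phi> c has_real_derivative exp (2 * c * r) * (2 * (c * (d r \<bullet> d r) + d r \<bullet> d' r))) (at r)"
    if "r \<in> closed_segment s t" for r c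
    unfolding \<phi>_def has_field_derivative_def
    by (rule has_derivative_eq_rhs,
        (rule derivative_intros d[OF that, unfolded has_vector_derivative_def])+)
      (auto simp: algebra_simps inner_commute fun_eq_iff)
  have dd': "\<bar>d r \<bullet> d' r\<bar> \<le> L * (d r \<bullet> d r)" if "r \<in> closed_segment s t" for r
  proof -
    have "\<bar>d r \<bullet> d' r\<bar> \<le> norm (d r) * norm (d' r)"
      by (rule Cauchy_Schwarz_ineq2)
    also have "\<dots> \<le> norm (d r) * (L * norm (d r))"
      using lip[OF that] by (intro mult_left_mono) (auto simp: d_def d'_def)
    finally show ?thesis
      by (simp add: dot_square_norm power2_eq_square mult_ac)
  qed
  have "norm (d s) ^ 2 \<le> exp (2 * (L * \<bar>t - s\<bar>)) * norm (d t) ^ 2"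
  proof (cases "s \<le> t")
    case True
    then have seg: "closed_segment s t = {s..t}"
      by (simp add: closed_segment_eq_real_ivl)
    have "\<phi> L s \<le> \<phi> L t"
    proof (rule DERIV_nonneg_imp_nondecreasing[OF True])
      fix r assume "s \<le> r" "r \<le> t"
      then have r: "r \<in> closed_segment s t" by (simp add: seg)
      show "\<exists>y. (\<phi> L has_real_derivative y) (at r) \<and> 0 \<le> y"
        using \<phi>[OF r, of L] dd'[OF r] by (intro exI conjI) auto
    qed
    moreover have "exp (2 * L * t) = exp (2 * L * s) * exp (2 * (L * \<bar>t - s\<bar>))"
      by (subst exp_add[symmetric]) (use True in \<open>simp add: algebra_simps\<close>)
    ultimately show ?thesis
      by (simp add: \<phi>_def dot_square_norm mult.assoc)
  next
    case False
    then have seg: "closed_segment s t = {t..s}"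
      by (simp add: closed_segment_eq_real_ivl)
    have "\<phi> (- L) t \<ge> \<phi> (- L) s"
    proof (rule DERIV_nonpos_imp_nonincreasing[where a = t and b = s])
      show "t \<le> s" using False by simp
      fix r assume "t \<le> r" "r \<le> s"
      then have r: "r \<in> closed_segment s t" by (simp add: seg)
      show "\<exists>y. (\<phi> (- L) has_real_derivative y) (at r) \<and> y \<le> 0"
        using \<phi>[OF r, of "- L"] dd'[OF r] by (intro exI conjI) (auto simp: mult_le_0_iff)
    qed
    moreover have "exp (2 * - L * t) = exp (2 * - L * s) * exp (2 * (L * \<bar>t - s\<bar>))"
      by (subst exp_add[symmetric]) (use False in \<open>simp add: algebra_simps\<close>)
    ultimately show ?thesis
      by (simp add: \<phi>_def dot_square_norm mult.assoc)
  qed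
  also have "\<dots> = (exp (L * \<bar>t - s\<bar>) * norm (d t)) ^ 2"
    by (simp add: power_mult_distrib exp_double)
  finally show ?thesis
    unfolding d_def by (rule power2_le_imp_le) simp
qed

text \<open>
  On the compact segment both curves are bounded, which is why the field need only be locally
  Lipschitz.
\<close>

lemma ode_unique:
  fixes u1 u2 :: "real \<Rightarrow> real ^ 'n::finite"
  assumes "td_vector_field Y"
    and u: "\<And>r. r \<in> closed_segment s t \<Longrightarrow> (u1 has_vector_derivative Y r (u1 r)) (at r)"
      "\<And>r. r \<in> closed_segment s t \<Longrightarrow> (u2 has_vector_derivative Y r (u2 r)) (at r)"
    and eq: "u1 t = u2 t"
  shows "u1 s = u2 s"
proof -
  let ?K = "closed_segment s t"
  have "continuous_on ?K u1" "continuous_on ?K u2"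
    using u by (auto intro!: continuous_at_imp_continuous_on has_vector_derivative_continuous)
  then have "bounded (u1 ` ?K \<union> u2 ` ?K)"
    by (auto intro!: compact_imp_bounded compact_continuous_image)
  then obtain R where R: "\<And>y. y \<in> u1 ` ?K \<union> u2 ` ?K \<Longrightarrow> norm y \<le> R"
    unfolding bounded_iff by blast
  obtain L where "\<And>r x y. r \<in> ?K \<Longrightarrow> norm x \<le> R \<Longrightarrow> norm y \<le> R \<Longrightarrow>
      norm (Y r x - Y r y) \<le> L * norm (x - y)"
    using td_vector_field_Lipschitz[OF assms(1) compact_segment] by metis
  then have "norm (u1 s - u2 s) \<le> exp (L * \<bar>t - s\<bar>) * norm (u1 t - u2 t)"
    using R u by (intro ode_distance_bound[where Y = Y]) auto
  with eq show ?thesis by simp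
qed

lemma integral_curve_segment:
  assumes "integral_curve X I \<gamma>" "t \<in> I" "r \<in> closed_segment 0 t"
  shows "r \<in> I" "(\<gamma> has_vector_derivative X r (\<gamma> r)) (at r)"
proof -
  show "r \<in> I"
    using assms closed_segment_subset[of 0 I t]
    unfolding integral_curve_def is_interval_convex_1 by blast
  then show "(\<gamma> has_vector_derivative X r (\<gamma> r)) (at r)"
    using assms by (simp add: integral_curve_def)
qed

lemma integral_curve_unique:
  fixes X :: "'n::finite tdvfield"
  assumes "td_vector_field X" "integral_curve X I \<gamma>" "integral_curve X J \<delta>"
    and "\<gamma> 0 = \<delta> 0" "t \<in> I" "t \<in> J"
  shows "\<gamma> t = \<delta> t"
proof (rule ode_unique[where s = t and t = 0 and ?u1.0 = \<gamma> and ?u2.0 = \<delta>, OF assms(1) _ _ assms(4)])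
  fix r assume "r \<in> closed_segment t 0"
  then have r: "r \<in> closed_segment 0 t" by (simp add: closed_segment_commute)
  show "(\<gamma> has_vector_derivative X r (\<gamma> r)) (at r)"
    by (rule integral_curve_segment(2)[OF assms(2,5) r])
  show "(\<delta> has_vector_derivative X r (\<delta> r)) (at r)"
    by (rule integral_curve_segment(2)[OF assms(3,6) r])
qed

lemma generalized_flow_curve:
  assumes "generalized_flow X D g"
  shows "integral_curve X {t. (t, x) \<in> D} (\<lambda>t. g t x)" "g 0 x = x"
  using assms by (simp_all add: generalized_flow_def)

lemma generalized_flow_segment:
  assumes "generalized_flow X D g" "(t, x) \<in> D" "r \<in> closed_segment 0 t"
  shows "(r, x) \<in> D" "((\<lambda>t. g t x) has_vector_derivative X r (g r x)) (at r)"
  using integral_curve_segment[OF generalized_flow_curve(1)[OF assms(1)], of t x r] assms(2,3)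
  by auto

lemma generalized_flow_zero: "generalized_flow X D g \<Longrightarrow> (0, x) \<in> D"
  by (simp add: generalized_flow_def integral_curve_def)

text \<open>
  Two curves of the flow that meet at time \<open>t\<close> can be followed back to time \<open>0\<close>.
\<close>

lemma generalized_flow_inj:
  fixes Y :: "'n::finite tdvfield"
  assumes "td_vector_field Y" "generalized_flow Y D g"
  shows "inj_on (g t) {x. (t, x) \<in> D}"
proof (rule inj_onI)
  fix x y assume xy: "x \<in> {x. (t, x) \<in> D}" "y \<in> {x. (t, x) \<in> D}" "g t x = g t y"
  have "g 0 x = g 0 y"
    by (rule ode_unique[where s = 0 and t = t and ?u1.0 = "\<lambda>t. g t x" and ?u2.0 = "\<lambda>t. g t y",
          OF assms(1) generalized_flow_segment(2)[OF assms(2)]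
            generalized_flow_segment(2)[OF assms(2)] xy(3)])
      (use xy in auto)
  then show "x = y"
    by (simp add: generalized_flow_curve(2)[OF assms(2)])
qed

text \<open>
  The distance bound from time \<open>t\<close> back to time \<open>0\<close>.  A single Lipschitz constant serves all starting
  points close to \<open>x0\<close> because, by the tube lemma, their curves up to time \<open>t\<close> stay in one bounded
  set.
\<close>

lemma generalized_flow_expansion:
  fixes Y :: "'n::finite tdvfield"
  assumes Y: "td_vector_field Y" and g: "generalized_flow Y D g" and D: "(t, x0) \<in> D"
  obtains \<delta> C where "\<delta> > 0" "C > 0"
    "\<And>x. norm (x - x0) \<le> \<delta> \<Longrightarrow> norm (x - x0) \<le> C * norm (g t x - g t x0)"
proof -
  let ?K = "closed_segment 0 t"
  have "(\<lambda>r. (r, x0)) ` ?K \<subseteq> D \<inter> (?K \<times> UNIV)"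
    using generalized_flow_segment(1)[OF g D] by auto
  moreover have "open D"
    using g by (simp add: generalized_flow_def)
  then have "openin (top_of_set (?K \<times> UNIV)) (D \<inter> (?K \<times> UNIV))"
    unfolding openin_open by blast
  ultimately obtain V where "openin (top_of_set UNIV) V" "x0 \<in> V" "?K \<times> V \<subseteq> D \<inter> (?K \<times> UNIV)"
    by (rule Retracts.tube_lemma[OF compact_segment, rotated]) auto
  then have V: "open V" "x0 \<in> V" "?K \<times> V \<subseteq> D"
    by auto
  then obtain \<delta> where \<delta>: "\<delta> > 0" "cball x0 \<delta> \<subseteq> V"
    by (meson open_contains_cball)
  have "Ck_on 0 D (\<lambda>(t, x). g t x)"
    using g unfolding generalized_flow_def smooth_on_def by blast
  then have "continuous_on (?K \<times> cball x0 \<delta>) (\<lambda>(t, x). g t x)"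
    using V(3) \<delta>(2) by (auto intro: continuous_on_subset)
  then have "bounded ((\<lambda>(t, x). g t x) ` (?K \<times> cball x0 \<delta>))"
    by (intro compact_imp_bounded compact_continuous_image compact_Times) auto
  then obtain R where R: "\<And>r x. r \<in> ?K \<Longrightarrow> x \<in> cball x0 \<delta> \<Longrightarrow> norm (g r x) \<le> R"
    unfolding bounded_iff by fastforce
  obtain L where L: "\<And>r x y. r \<in> ?K \<Longrightarrow> norm x \<le> R \<Longrightarrow> norm y \<le> R \<Longrightarrow>
      norm (Y r x - Y r y) \<le> L * norm (x - y)"
    using td_vector_field_Lipschitz[OF Y compact_segment] by metis
  have "norm (x - x0) \<le> exp (L * \<bar>t\<bar>) * norm (g t x - g t x0)" if "norm (x - x0) \<le> \<delta>" for x
  proof -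
    have x: "x \<in> cball x0 \<delta>" "x0 \<in> cball x0 \<delta>"
      using that \<delta>(1) by (auto simp: dist_norm norm_minus_commute)
    moreover have "t \<in> ?K" by simp
    ultimately have "(t, x) \<in> D"
      using V(3) \<delta>(2) by blast
    then have "norm (g 0 x - g 0 x0) \<le> exp (L * \<bar>t - 0\<bar>) * norm (g t x - g t x0)"
      by (rule ode_distance_bound[where ?u1.0 = "\<lambda>t. g t x" and ?u2.0 = "\<lambda>t. g t x0" and Y = Y,
            OF generalized_flow_segment(2)[OF g] generalized_flow_segment(2)[OF g D]])
        (use x in \<open>auto intro!: L R\<close>)
    then show ?thesis
      by (simp add: generalized_flow_curve(2)[OF g])
  qed
  with \<delta>(1) show ?thesis
    by (intro that[of \<delta> "exp (L * \<bar>t\<bar>)"]) auto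
qed

lemma derivative_injective_if_expanding:
  fixes f :: "'a::real_normed_vector \<Rightarrow> 'b::real_normed_vector"
  assumes f': "(f has_derivative f') (at x0)" and "\<delta> > 0" "C > 0"
    and exp: "\<And>x. norm (x - x0) \<le> \<delta> \<Longrightarrow> norm (x - x0) \<le> C * norm (f x - f x0)"
    and "f' v = 0"
  shows "v = 0"
proof (rule ccontr)
  assume v: "v \<noteq> 0"
  interpret bounded_linear f' using f' by (rule has_derivative_bounded_linear)
  have "1 / (2 * C) > 0" using \<open>C > 0\<close> by simp
  then obtain d where d: "d > 0" "\<And>y. norm (y - x0) < d \<Longrightarrow>
      norm (f y - f x0 - f' (y - x0)) \<le> 1 / (2 * C) * norm (y - x0)"
    using f' unfolding has_derivative_at_alt by blast
  define h where "h = min (d / 2) \<delta> / norm v"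
  define y where "y = x0 + h *\<^sub>R v"
  have h: "h > 0" using d \<open>\<delta> > 0\<close> v by (simp add: h_def)
  have norm_y: "norm (y - x0) = min (d / 2) \<delta>"
    using d \<open>\<delta> > 0\<close> v by (simp add: y_def h_def)
  have "f' (y - x0) = 0" using \<open>f' v = 0\<close> by (simp add: y_def scaleR)
  then have "norm (f y - f x0) \<le> 1 / (2 * C) * norm (y - x0)"
    using d(2)[of y] norm_y d(1) by simp
  then have "C * norm (f y - f x0) \<le> norm (y - x0) / 2"
    using \<open>C > 0\<close> by (simp add: field_simps)
  moreover have "norm (y - x0) \<le> C * norm (f y - f x0)"
    using norm_y by (intro exp) simp
  moreover have "norm (y - x0) > 0"
    using norm_y d(1) \<open>\<delta> > 0\<close> by simp
  ultimately show False
    by linarith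
qed

text \<open>
  Deducing this from the distance bound, rather than from the variational equation for
  \<open>D\<^sub>xg\<^sub>t\<close>, makes it unnecessary to interchange the derivatives in \<open>t\<close> and in \<open>x\<close>.
\<close>

lemma generalized_flow_derivative_injective:
  fixes Y :: "'n::finite tdvfield"
  assumes "td_vector_field Y" "generalized_flow Y D g" "(t, x) \<in> D"
    and "(g t has_derivative A) (at x)" "A v = 0"
  shows "v = 0"
  using derivative_injective_if_expanding[OF assms(4) _ _ _ assms(5)]
    generalized_flow_expansion[OF assms(1-3)] by metis


section \<open>Smoothness of the inverse of a generalized flow\<close>

text \<open>
  Joint smoothness of \<open>(t, y) \<mapsto> g\<^sub>t\<^sup>-\<^sup>1 y\<close>.  The map \<open>F (t, x) = (t, g\<^sub>t x)\<close> is continuous and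
  injective between spaces of the same dimension, so by invariance of domain its image is open and
  its inverse \<open>G\<close> is continuous.  As \<open>D\<^sub>xg\<^sub>t\<close> is injective, the derivative of \<open>F\<close> is invertible,
  and \<open>G\<close> is differentiable with the inverse derivative.  This derivative solves a
  linear system whose coefficients are derivatives of \<open>g\<close> evaluated along \<open>G\<close>; hence if \<open>G\<close> is of
  class \<open>C\<^sup>k\<close>, so is its derivative, and \<open>G\<close> is of class \<open>C\<^sup>k\<^sup>+\<^sup>1\<close>.
\<close>

lemma generalized_flow_inverse:
  fixes Y :: "'n::finite tdvfield"
  assumes Y: "td_vector_field Y" and g: "generalized_flow Y D g"
  defines "F \<equiv> \<lambda>(t, x). (t, g t x)"
    and "\<gamma> \<equiv> \<lambda>(t, y). inv_into {x. (t, x) \<in> D} (g t) y"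
  shows "open (F ` D)" "smooth_on (F ` D) \<gamma>"
proof -
  define gg where "gg = (\<lambda>(t, x). g t x)"
  define g' where "g' = (\<lambda>z. frechet_derivative gg (at z))"
  define G where "G = (\<lambda>y. (fst y, \<gamma> y))"
  have D: "open D" and Ck_g: "Ck_on k D gg" for k
    using g by (auto simp: generalized_flow_def smooth_on_def gg_def)
  have g': "(gg has_derivative g' z) (at z)" if "z \<in> D" for z
    unfolding g'_def by (rule Ck_on_Suc_has_derivative[OF Ck_g that])
  have F_eq: "F = (\<lambda>z. (fst z, gg z))"
    by (auto simp: F_def gg_def)
  have cont_F: "continuous_on D F"
    unfolding F_eq by (intro continuous_intros Ck_on_continuous[OF Ck_g])
  have inj: "inj_on (g t) {x. (t, x) \<in> D}" for t
    by (rule generalized_flow_inj[OF Y g])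
  then have "inj_on F D"
    by (auto simp: F_def inj_on_def)
  with cont_F D show open_FD: "open (F ` D)"
    by (intro invariance_of_domain)
  have G_F: "G (F z) = z" if "z \<in> D" for z
    using that inj by (auto simp: G_def F_def \<gamma>_def inv_into_f_f split: prod.splits)
  then have G_D: "G y \<in> D" if "y \<in> F ` D" for y
    using that by auto
  have cont_G: "continuous_on (F ` D) G"
    using continuous_on_inverse_open[OF D cont_F order_refl] G_F by blast
  \<comment> \<open>\<open>A z\<close> is the matrix of \<open>D\<^sub>xg\<^sub>t\<close> at \<open>z = (t, x)\<close>.\<close>
  define A where "A = (\<lambda>z. \<chi> i j. g' z (0, axis j 1) $ i)"
  have A: "A z *v w = g' z (0, w)" if "z \<in> D" for z w
  proof -
    have "linear (g' z)"
      using g'[OF that] by (rule has_derivative_linear)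
    then have "linear (\<lambda>v. g' z (0, v))"
      using linear_compose[of "\<lambda>v. (0, v)" "g' z"] by (simp add: o_def linear_iff)
    then show ?thesis
      using matrix_works[of "\<lambda>v. g' z (0, v)" w]
      by (simp add: A_def matrix_def linear_matrix_vector_mul_eq)
  qed
  have ker: "w = 0" if z: "z \<in> D" and w: "g' z (0, w) = 0" for z w
  proof -
    obtain t x where tx: "z = (t, x)" by force
    have "((\<lambda>x. gg (t, x)) has_derivative (\<lambda>v. g' z (0, v))) (at x)"
      by (rule has_derivative_compose[where f = "Pair t" and f' = "Pair 0" and g = gg and g' = "g' z"])
        (use g'[OF z] tx in \<open>auto intro!: derivative_eq_intros\<close>)
    then have "(g t has_derivative (\<lambda>v. g' z (0, v))) (at x)"
      by (simp add: gg_def)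
    then show ?thesis
      using generalized_flow_derivative_injective[OF Y g z[unfolded tx]] w by blast
  qed
  have det: "det (A z) \<noteq> 0" if "z \<in> D" for z
    using ker[OF that] A[OF that] invertible_det_nz matrix_left_invertible_ker
      invertible_left_inverse by metis
  define F' where "F' = (\<lambda>z v. (fst v, g' z v))"
  have F': "(F has_derivative F' z) (at z)" if "z \<in> D" for z
    unfolding F_eq F'_def by (intro derivative_intros g' that)
  have "\<exists>H. linear H \<and> H \<circ> F' z = id \<and> F' z \<circ> H = id" if "z \<in> D" for z
  proof -
    have lin: "linear (F' z)"
      using F'[OF that] by (rule has_derivative_linear)
    have "inj (F' z)"
      unfolding linear_injective_0[OF lin] using ker[OF that] by (auto simp: F'_def zero_prod_def)
    then obtain H where H: "linear H" "H \<circ> F' z = id"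
      using linear_injective_left_inverse[OF lin] by blast
    then show ?thesis
      using linear_inverse_left[OF lin H(1)] by blast
  qed
  then obtain H where H: "\<And>z. z \<in> D \<Longrightarrow> linear (H z)" "\<And>z. z \<in> D \<Longrightarrow> H z \<circ> F' z = id"
      "\<And>z. z \<in> D \<Longrightarrow> F' z \<circ> H z = id"
    by metis
  have G': "(G has_derivative H (G y)) (at y)" if y: "y \<in> F ` D" for y
  proof -
    obtain z where z: "y = F z" "z \<in> D"
      using y by (rule imageE)
    have H_z: "bounded_linear (H z)"
      using H(1)[OF z(2)] by (simp add: linear_conv_bounded_linear)
    have "(G has_derivative H z) (at (F z))"
      by (rule has_derivative_inverse_dieudonne[OF D open_FD cont_F cont_G _ z(2) F'[OF z(2)] H_z H(2)[OF z(2)]])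
        (rule G_F)
    then show ?thesis
      using z(1) G_F[OF z(2)] by simp
  qed
  have \<gamma>_eq: "\<gamma> = (\<lambda>y. snd (G y))"
    by (simp add: G_def)
  \<comment> \<open>The second component of \<open>F' (H v) = v\<close>, with the time part moved to the right-hand side.\<close>
  have solve: "A (G y) *v snd (H (G y) v) = snd v - fst v *\<^sub>R g' (G y) (1, 0)" if "y \<in> F ` D" for y v
  proof -
    let ?z = "G y" and ?w = "H (G y) v"
    have lin: "linear (g' ?z)"
      using g'[OF G_D[OF that]] by (rule has_derivative_linear)
    have eq: "fst ?w = fst v" "g' ?z ?w = snd v"
      using fun_cong[OF H(3)[OF G_D[OF that]], of v] by (auto simp: F'_def prod_eq_iff)
    have "?w = fst v *\<^sub>R (1, 0) + (0, snd ?w)"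
      by (simp add: prod_eq_iff eq)
    then have "g' ?z ?w = fst v *\<^sub>R g' ?z (1, 0) + g' ?z (0, snd ?w)"
      using linear_add[OF lin] linear_scale[OF lin] by metis
    then show ?thesis
      using A[OF G_D[OF that]] eq by simp
  qed
  have "Ck_on k (F ` D) \<gamma>" for k
  proof (induction k)
    case 0
    then show ?case
      using cont_G by (auto simp: \<gamma>_eq intro: continuous_on_snd)
  next
    case (Suc k)
    have Ck_G: "Ck_on k (F ` D) G"
      unfolding G_def by (intro Ck_on_Pair Suc open_FD Ck_on_bounded_linear bounded_linear_fst)
    have Ck_g': "Ck_on k (F ` D) (\<lambda>y. g' (G y) v)" for v
    proof (rule Ck_on_compose[OF open_FD _ Ck_G G_D])
      show "Ck_on k D (\<lambda>z. g' z v)"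
        using Ck_g[of "Suc k"] unfolding g'_def Ck_on.simps by blast
    qed
    show ?case
    proof (rule Ck_on_SucI[OF open_FD])
      show "(\<gamma> has_derivative (\<lambda>v. snd (H (G y) v))) (at y)" if "y \<in> F ` D" for y
        unfolding \<gamma>_eq by (intro has_derivative_snd G' that)
      show "Ck_on k (F ` D) (\<lambda>y. snd (H (G y) v))" for v
      proof (rule Ck_on_linear_solve[OF open_FD])
        show "Ck_on k (F ` D) (\<lambda>y. A (G y) $ i $ j)" for i j
          unfolding A_def
          using Ck_on_linear_compose[OF open_FD bounded_linear_vec_nth Ck_g'] by simp
        have "Ck_on k (F ` D) (\<lambda>y. snd v + (- fst v) *\<^sub>R g' (G y) (1, 0))"
          by (intro Ck_on_add Ck_on_scaleR Ck_on_const open_FD Ck_g')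
        then show "Ck_on k (F ` D) (\<lambda>y. snd v - fst v *\<^sub>R g' (G y) (1, 0))"
          by simp
      qed (use solve det G_D in auto)
    qed
  qed
  then show "smooth_on (F ` D) \<gamma>"
    by (simp add: smooth_on_def)
qed


section \<open>Smooth functions of tuples\<close>

lemma bounded_linear_apply_bcontfun:
  "bounded_linear (\<lambda>p :: 'a::topological_space \<Rightarrow>\<^sub>C 'b::real_normed_vector. apply_bcontfun p a)"
  by (rule bounded_linear_intro[where K = 1]) (auto simp: norm_bounded)

lemma tuple_cong: "(\<And>a. a < m \<Longrightarrow> x a = y a) \<Longrightarrow> tuple m x = tuple m y"
  by (rule bcontfun_eqI) (simp add: apply_tuple)

text \<open>
  Tuples of length \<open>m\<close> fill a finite-dimensional subspace of the space of sequences; this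
  makes \<open>Ck_on_compose_span\<close> applicable to maps into it.
\<close>

lemma tuple_span:
  "tuple m x = (\<Sum>(a, b)\<in>{..<m} \<times> Basis. (x a \<bullet> b) *\<^sub>R tuple m (\<lambda>i. if i = a then b else 0))"
proof (rule bcontfun_eqI)
  fix i
  have lin: "linear (\<lambda>p :: 'a seqs. apply_bcontfun p i)"
    by (rule bounded_linear.linear[OF bounded_linear_apply_bcontfun])
  have "apply_bcontfun (\<Sum>(a, b)\<in>{..<m} \<times> Basis.
      (x a \<bullet> b) *\<^sub>R tuple m (\<lambda>i. if i = a then b else 0)) i =
    (\<Sum>a<m. \<Sum>b\<in>Basis. (x a \<bullet> b) *\<^sub>R apply_bcontfun (tuple m (\<lambda>i. if i = a then b else 0)) i)"
    unfolding linear_sum[OF lin] sum.cartesian_product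
    by (rule sum.cong) (auto simp: scaleR_bcontfun.rep_eq)
  also have "\<dots> = (\<Sum>a<m. if i = a then x a else 0)"
    by (rule sum.cong) (auto simp: apply_tuple euclidean_representation intro!: sum.neutral)
  also have "\<dots> = apply_bcontfun (tuple m x) i"
    by (simp add: apply_tuple)
  finally show "apply_bcontfun (tuple m x) i = apply_bcontfun (\<Sum>(a, b)\<in>{..<m} \<times> Basis.
      (x a \<bullet> b) *\<^sub>R tuple m (\<lambda>i. if i = a then b else 0)) i" ..
qed

lemma Ck_on_compose_tuple:
  fixes c :: "nat \<Rightarrow> 'a::real_normed_vector \<Rightarrow> real ^ 'n::finite"
    and \<kappa> :: "'a \<Rightarrow> 'b::euclidean_space"
  assumes "open S" "\<And>a. a < m \<Longrightarrow> Ck_on j S (c a)" "Ck_on j S \<kappa>" "Ck_on j T f"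
    and "\<And>z. z \<in> S \<Longrightarrow> (0, tuple m (\<lambda>a. c a z), \<kappa> z) \<in> T"
  shows "Ck_on j S (\<lambda>z. f (0 :: real, tuple m (\<lambda>a. c a z), \<kappa> z))"
proof (rule Ck_on_compose_span[OF assms(1) _ _ assms(5,4)])
  let ?I = "({..<m} \<times> (Basis :: (real ^ 'n) set)) <+> (Basis :: 'b set)"
  define coord where "coord = case_sum (\<lambda>(a, b) z. c a z \<bullet> b) (\<lambda>b z. \<kappa> z \<bullet> b)"
  define e where "e = case_sum (\<lambda>(a, b :: real ^ 'n). (0 :: real, tuple m (\<lambda>i. if i = a then b else 0), 0))
    (\<lambda>b :: 'b. (0, 0, b))"
  show "finite ?I" by simp
  show "(0, tuple m (\<lambda>a. c a z), \<kappa> z) = (\<Sum>i\<in>?I. coord i z *\<^sub>R e i)" for z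
    unfolding coord_def e_def
    by (simp add: sum.Plus prod_eq_iff fst_sum snd_sum case_prod_beta euclidean_representation)
      (simp add: tuple_span[of m "\<lambda>a. c a z"] case_prod_beta)
  show "Ck_on j S (coord i)" if "i \<in> ?I" for i
    using that assms(2,3) unfolding coord_def
    by (auto intro!: Ck_on_inner_const assms(1))
qed

text \<open>
  The transformed function is the composition \<open>\<gamma> \<circ> N\<close>, where \<open>\<gamma> (t, y) = g\<^sub>t\<^sup>-\<^sup>1 y\<close> is smooth on the
  open image of the flow and \<open>N (t, p, k) = (t, \<Phi> (g\<^sub>t p\<^sub>1, \<dots>, g\<^sub>t p\<^sub>m, k))\<close>; its domain is the set of
  points where this composition makes sense.
\<close>

lemma transformed_superposition_smooth:
  fixes Y :: "'n::finite tdvfield"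
  assumes Y: "td_vector_field Y" and g: "generalized_flow Y D g"
    and U: "open (UNIV \<times> U :: (real \<times> 'n seqs \<times> (real ^ 'n)) set)"
    and \<Phi>: "smooth_on (UNIV \<times> U) (\<lambda>(t :: real, p, k). \<Phi> (p, k))"
  shows "open (transformed_domain m D g U \<Phi>)"
    "smooth_on (transformed_domain m D g U \<Phi>) (transformed_superposition m D g \<Phi>)"
proof -
  define \<psi> where "\<psi> = (\<lambda>(t :: real, p :: 'n seqs, k). \<Phi> (p, k))"
  define ev where "ev = (\<lambda>a (z :: real \<times> 'n seqs \<times> (real ^ 'n)).
    (fst z, apply_bcontfun (fst (snd z)) a))"
  define gg where "gg = (\<lambda>(t, x). g t x)"
  define M where "M = (\<lambda>z. (0 :: real, tuple m (\<lambda>a. gg (ev a z)), snd (snd z)))"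
  define N where "N = (\<lambda>z. (fst z, \<psi> (M z)))"
  define FD where "FD = (\<lambda>(t, x). (t, g t x)) ` D"
  define \<gamma> where "\<gamma> = (\<lambda>(t, y). inv_into {x. (t, x) \<in> D} (g t) y)"
  define P where "P = {z. \<forall>a<m. ev a z \<in> D}"
  define Q where "Q = P \<inter> M -` (UNIV \<times> U)"
  have D: "open D" and Ck_g: "Ck_on j D gg" for j
    using g by (auto simp: generalized_flow_def smooth_on_def gg_def)
  have ev: "bounded_linear (ev a)" for a
    unfolding ev_def
    by (intro bounded_linear_Pair bounded_linear_fst
        bounded_linear_compose[OF bounded_linear_apply_bcontfun]
        bounded_linear_compose[OF bounded_linear_fst] bounded_linear_snd)
  have "P = (\<Inter>a\<in>{..<m}. ev a -` D)"
    by (auto simp: P_def)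
  then have P: "open P"
    using D by (auto intro!: open_INT open_vimage linear_continuous_on ev)
  have Ck_c: "Ck_on j P (\<lambda>z. gg (ev a z))" if "a < m" for a j
    by (rule Ck_on_compose[OF P Ck_g Ck_on_bounded_linear[OF P ev]])
      (use that in \<open>auto simp: P_def\<close>)
  have Ck_k: "Ck_on j P (\<lambda>z. snd (snd z))" for j
    by (intro Ck_on_bounded_linear P bounded_linear_compose[OF bounded_linear_snd] bounded_linear_snd)
  have "Ck_on 0 P M"
    unfolding M_def
    by (rule Ck_on_compose_tuple[OF P Ck_c Ck_k, where T = UNIV and f = "\<lambda>z. z"]) auto
  then have Q: "open Q"
    unfolding Q_def by (intro continuous_open_preimage P U) simp
  have Ck_\<psi>: "Ck_on j Q (\<lambda>z. \<psi> (M z))" for j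
    unfolding M_def
  proof (rule Ck_on_compose_tuple[OF Q])
    show "Ck_on j (UNIV \<times> U) \<psi>"
      using \<Phi> by (simp add: smooth_on_def \<psi>_def)
    show "Ck_on j Q (\<lambda>z. gg (ev a z))" if "a < m" for a
      using Ck_c[OF that] by (rule Ck_on_subset) (auto simp: Q_def)
    show "Ck_on j Q (\<lambda>z. snd (snd z))"
      using Ck_k by (rule Ck_on_subset) (auto simp: Q_def)
  qed (simp add: Q_def M_def)
  have Ck_N: "Ck_on j Q N" for j
    unfolding N_def by (intro Ck_on_Pair Q Ck_\<psi> Ck_on_bounded_linear bounded_linear_fst)
  have FD: "open FD" "smooth_on FD \<gamma>"
    using generalized_flow_inverse[OF Y g] by (simp_all add: FD_def \<gamma>_def)
  have dom: "transformed_domain m D g U \<Phi> = Q \<inter> N -` FD"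
    by (auto simp: transformed_domain_def Q_def P_def N_def M_def FD_def \<psi>_def ev_def gg_def image_iff)
  have "continuous_on Q N"
    by (rule Ck_on_continuous[OF Ck_N])
  then show "open (transformed_domain m D g U \<Phi>)"
    unfolding dom by (intro continuous_open_preimage Q FD)
  then have "Ck_on j (Q \<inter> N -` FD) (\<lambda>z. \<gamma> (N z))" for j
    unfolding dom
    by (rule Ck_on_compose[where T = FD])
      (use FD(2) Ck_N in \<open>auto simp: smooth_on_def intro: Ck_on_subset\<close>)
  moreover have "(\<lambda>z. \<gamma> (N z)) = transformed_superposition m D g \<Phi>"
    by (auto simp: transformed_superposition_def \<gamma>_def N_def M_def \<psi>_def ev_def gg_def)
  ultimately show "smooth_on (transformed_domain m D g U \<Phi>) (transformed_superposition m D g \<Phi>)"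
    by (simp add: smooth_on_def dom)
qed


section \<open>Superposition of transformed solutions\<close>

lemma integral_curve_subset:
  "integral_curve X I \<gamma> \<Longrightarrow> J \<subseteq> I \<Longrightarrow> open J \<Longrightarrow> is_interval J \<Longrightarrow> 0 \<in> J \<Longrightarrow> integral_curve X J \<gamma>"
  by (auto simp: integral_curve_def)

lemma integral_curve_cong:
  assumes "integral_curve X I \<gamma>" "\<And>t. t \<in> I \<Longrightarrow> \<delta> t = \<gamma> t"
  shows "integral_curve X I \<delta>"
  unfolding integral_curve_def
proof (intro conjI ballI)
  fix t assume t: "t \<in> I"
  have "(\<delta> has_vector_derivative X t (\<gamma> t)) (at t)"
    by (rule has_vector_derivative_transform_within_open[where S = I and f = \<gamma>])
      (use assms t in \<open>auto simp: integral_curve_def\<close>)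
  then show "(\<delta> has_vector_derivative X t (\<delta> t)) (at t)"
    using assms(2)[OF t] by simp
qed (use assms(1) in \<open>auto simp: integral_curve_def\<close>)

text \<open>
  By maximality of the flow of \<open>X\<close>, every integral curve of \<open>X\<close> is a piece of a flow line, and
  \<open>g\<close> maps flow lines of \<open>X\<close> to flow lines of \<open>Z = g\<^sub>\<bigstar> X\<close>.  The intervals are
  symmetric and arbitrarily small so that finitely many curves can share one.
\<close>

lemma action_pushes_integral_curves:
  assumes "is_action D g X Z" "integral_curve X I x"
  shows "\<forall>\<^sub>F \<epsilon> in at_right 0. integral_curve Z {-\<epsilon><..<\<epsilon>} (\<lambda>t. g t (x t)) \<and>
    (\<forall>t. \<bar>t\<bar> < \<epsilon> \<longrightarrow> t \<in> I \<and> (t, x t) \<in> D)"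
proof -
  obtain E f where f: "maximal_flow X E f"
    "generalized_flow Z (comp_dom D E f) (\<lambda>t x. g t (f t x))"
    using assms(1) unfolding is_action_def by blast
  define S where "S = {t. (t, x 0) \<in> comp_dom D E f}"
  have curve: "integral_curve Z S (\<lambda>t. g t (f t (x 0)))"
    using generalized_flow_curve(1)[OF f(2)] by (simp add: S_def)
  have eq: "f t (x 0) = x t" if "t \<in> I" for t
    using f(1) assms(2) that unfolding maximal_flow_def by blast
  have "open (S \<inter> I)" "0 \<in> S \<inter> I"
    using curve assms(2) by (auto simp: integral_curve_def)
  then obtain d where d: "d > 0" "ball 0 d \<subseteq> S \<inter> I"
    by (meson openE)
  show ?thesis
    using eventually_at_right_real[OF d(1)]
  proof eventually_elim
    case (elim \<epsilon>)
    then have "{-\<epsilon><..<\<epsilon>} \<subseteq> ball 0 d" by (auto simp: dist_real_def)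
    then have sub: "{-\<epsilon><..<\<epsilon>} \<subseteq> S \<inter> I" using d(2) by blast
    then have "integral_curve Z {-\<epsilon><..<\<epsilon>} (\<lambda>t. g t (f t (x 0)))"
      using elim by (intro integral_curve_subset[OF curve]) (auto simp: is_interval_oo)
    then have "integral_curve Z {-\<epsilon><..<\<epsilon>} (\<lambda>t. g t (x t))"
      by (rule integral_curve_cong) (use sub eq in auto)
    moreover have "t \<in> I \<and> (t, x t) \<in> D" if "\<bar>t\<bar> < \<epsilon>" for t
    proof -
      have "t \<in> S" "t \<in> I" using sub that by (auto simp: abs_less_iff)
      moreover from this have "(t, f t (x 0)) \<in> D"
        using ends_in_segment(2)[of 0 t] by (auto simp: S_def comp_dom_def)
      ultimately show ?thesis
        using eq by auto
    qed
    ultimately show ?case by blast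
  qed
qed

text \<open>
  The generic set \<open>N\<close> is the one of \<open>\<Phi>\<close>, since \<open>g\<^sub>0\<close> is the identity and genericity
  only concerns the initial conditions.
\<close>

lemma transformed_superposition_function:
  fixes Y :: "'n::finite tdvfield"
  assumes Y: "td_vector_field Y" and g: "generalized_flow Y D g"
    and \<Phi>: "associated_superposition_function V0 m N U \<Phi>"
  shows "superposition_function (scheme_family V V0 D g) m N
     (transformed_domain m D g U \<Phi>) (transformed_superposition m D g \<Phi>)"
proof -
  let ?U = "transformed_domain m D g U \<Phi>" and ?\<Phi> = "transformed_superposition m D g \<Phi>"
  note \<Phi> = \<Phi>[unfolded associated_superposition_function_def superposition_function_def]
  have g0: "g 0 x = x" and D0: "(0, x) \<in> D" for x
    using generalized_flow_curve(2)[OF g] generalized_flow_zero[OF g] by auto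
  have inj: "inj_on (g t) {x. (t, x) \<in> D}" for t
    by (rule generalized_flow_inj[OF Y g])
  have tuple_g: "tuple m (\<lambda>a. g t (apply_bcontfun (tuple m \<xi>) a)) = tuple m (\<lambda>a. g t (\<xi> a))" for t \<xi>
    by (rule tuple_cong) (simp add: apply_tuple)
  have transfer: "(t, tuple m \<xi>, k) \<in> ?U \<and> ?\<Phi> (t, tuple m \<xi>, k) = y"
    if "\<And>a. a < m \<Longrightarrow> (t, \<xi> a) \<in> D" "(tuple m (\<lambda>a. g t (\<xi> a)), k) \<in> U"
      "\<Phi> (tuple m (\<lambda>a. g t (\<xi> a)), k) = g t y" "(t, y) \<in> D" for t \<xi> k y
    unfolding transformed_domain_def transformed_superposition_def mem_Collect_eq prod.case tuple_g
    using that inj[of t] by (auto simp: apply_tuple inv_into_f_f)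
  have main: "(\<forall>J y. integral_curve X J y \<and> (tuple m (\<lambda>a. x a 0), y 0) \<in> N \<longrightarrow>
           (\<exists>k. \<exists>\<epsilon>>0. \<forall>t. \<bar>t\<bar> < \<epsilon> \<longrightarrow>
              (t, tuple m (\<lambda>a. x a t), k) \<in> ?U \<and> y t = ?\<Phi> (t, tuple m (\<lambda>a. x a t), k))) \<and>
        (\<forall>k. (0, tuple m (\<lambda>a. x a 0), k) \<in> ?U \<and>
             (tuple m (\<lambda>a. x a 0), ?\<Phi> (0, tuple m (\<lambda>a. x a 0), k)) \<in> N \<longrightarrow>
           (\<exists>\<epsilon>>0. (\<forall>t. \<bar>t\<bar> < \<epsilon> \<longrightarrow> (t, tuple m (\<lambda>a. x a t), k) \<in> ?U) \<and>
              integral_curve X {-\<epsilon><..<\<epsilon>} (\<lambda>t. ?\<Phi> (t, tuple m (\<lambda>a. x a t), k))))"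
    if X: "X \<in> scheme_family V V0 D g" and x: "\<And>a. a < m \<Longrightarrow> integral_curve X (I a) (x a)"
    for X x I
  proof -
    obtain Z where Z: "Z \<in> td_fields V0" "is_action D g X Z"
      using X by (auto simp: scheme_family_def)
    have x_ev: "\<forall>\<^sub>F \<epsilon> in at_right 0. \<forall>a\<in>{..<m}. integral_curve Z {-\<epsilon><..<\<epsilon>} (\<lambda>t. g t (x a t)) \<and>
      (\<forall>t. \<bar>t\<bar> < \<epsilon> \<longrightarrow> t \<in> I a \<and> (t, x a t) \<in> D)"
      by (rule eventually_ball_finite) (auto intro: action_pushes_integral_curves[OF Z(2) x])
    have push: "\<exists>\<delta>>0. (\<forall>a<m. integral_curve Z {-\<delta><..<\<delta>} (\<lambda>t. g t (x a t))) \<and>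
        integral_curve Z {-\<delta><..<\<delta>} (\<lambda>t. g t (y t)) \<and>
        (\<forall>t. \<bar>t\<bar> < \<delta> \<longrightarrow> t \<in> J \<and> (t, y t) \<in> D \<and> (\<forall>a<m. (t, x a t) \<in> D))"
      if "integral_curve X J y" for J y
      using eventually_happens[OF eventually_conj[OF eventually_at_right_less[of 0]
        eventually_conj[OF x_ev action_pushes_integral_curves[OF Z(2) that]]]]
      by (auto simp: trivial_limit_at_right_real)
    \<comment> \<open>The two halves of the superposition property of \<open>\<Phi>\<close> for the field \<open>Z\<close>.\<close>
    have \<Phi>1: "\<exists>k. \<exists>\<epsilon>>0. \<forall>t. \<bar>t\<bar> < \<epsilon> \<longrightarrow>
        (tuple m (\<lambda>a. \<xi> a t), k) \<in> U \<and> \<eta> t = \<Phi> (tuple m (\<lambda>a. \<xi> a t), k)"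
      if "\<And>a. a < m \<Longrightarrow> integral_curve Z (L a) (\<xi> a)" "integral_curve Z J \<eta>"
        "(tuple m (\<lambda>a. \<xi> a 0), \<eta> 0) \<in> N" for \<xi> L J \<eta>
      using \<Phi> Z(1) that by (simp add: split_beta) blast
    have \<Phi>2: "\<exists>\<epsilon>>0. (\<forall>t. \<bar>t\<bar> < \<epsilon> \<longrightarrow> (tuple m (\<lambda>a. \<xi> a t), k) \<in> U) \<and>
        integral_curve Z {-\<epsilon><..<\<epsilon>} (\<lambda>t. \<Phi> (tuple m (\<lambda>a. \<xi> a t), k))"
      if "\<And>a. a < m \<Longrightarrow> integral_curve Z (L a) (\<xi> a)" "(tuple m (\<lambda>a. \<xi> a 0), k) \<in> U"
        "(tuple m (\<lambda>a. \<xi> a 0), \<Phi> (tuple m (\<lambda>a. \<xi> a 0), k)) \<in> N" for \<xi> L k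
      using \<Phi> Z(1) that by (simp add: split_beta) blast
    show ?thesis
    proof (intro conjI allI impI; elim conjE)
      fix J y assume y: "integral_curve X J y" and N: "(tuple m (\<lambda>a. x a 0), y 0) \<in> N"
      obtain \<delta> where \<delta>: "\<delta> > 0" "\<And>a. a < m \<Longrightarrow> integral_curve Z {-\<delta><..<\<delta>} (\<lambda>t. g t (x a t))"
          "integral_curve Z {-\<delta><..<\<delta>} (\<lambda>t. g t (y t))"
          "\<And>t. \<bar>t\<bar> < \<delta> \<Longrightarrow> (t, y t) \<in> D" "\<And>t a. \<bar>t\<bar> < \<delta> \<Longrightarrow> a < m \<Longrightarrow> (t, x a t) \<in> D"
        using push[OF y] by blast
      obtain k \<epsilon> where k: "\<epsilon> > 0" "\<And>t. \<bar>t\<bar> < \<epsilon> \<Longrightarrow> (tuple m (\<lambda>a. g t (x a t)), k) \<in> U"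
          "\<And>t. \<bar>t\<bar> < \<epsilon> \<Longrightarrow> g t (y t) = \<Phi> (tuple m (\<lambda>a. g t (x a t)), k)"
        using \<Phi>1[where \<xi> = "\<lambda>a t. g t (x a t)", OF \<delta>(2,3)] N by (auto simp: g0)
      have "(t, tuple m (\<lambda>a. x a t), k) \<in> ?U \<and> y t = ?\<Phi> (t, tuple m (\<lambda>a. x a t), k)"
        if "\<bar>t\<bar> < min \<epsilon> \<delta>" for t
        using transfer[of t "\<lambda>a. x a t" k "y t"] that k \<delta> by auto
      then show "\<exists>k. \<exists>\<epsilon>>0. \<forall>t. \<bar>t\<bar> < \<epsilon> \<longrightarrow>
          (t, tuple m (\<lambda>a. x a t), k) \<in> ?U \<and> y t = ?\<Phi> (t, tuple m (\<lambda>a. x a t), k)"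
        using k(1) \<delta>(1) by (intro exI[of _ k] exI[of _ "min \<epsilon> \<delta>"]) auto
    next
      fix k assume k: "(0, tuple m (\<lambda>a. x a 0), k) \<in> ?U"
        and N: "(tuple m (\<lambda>a. x a 0), ?\<Phi> (0, tuple m (\<lambda>a. x a 0), k)) \<in> N"
      define y0 where "y0 = \<Phi> (tuple m (\<lambda>a. x a 0), k)"
      have U0: "(tuple m (\<lambda>a. x a 0), k) \<in> U"
        using k tuple_g[of 0 "\<lambda>a. x a 0"] by (simp add: transformed_domain_def g0)
      have "?\<Phi> (0, tuple m (\<lambda>a. x a 0), k) = y0"
        using transfer[of 0 "\<lambda>a. x a 0" k y0] U0 by (simp add: g0 D0 y0_def)
      with N have N0: "(tuple m (\<lambda>a. x a 0), y0) \<in> N" by simp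
      \<comment> \<open>The candidate solution is the flow line of \<open>X\<close> through \<open>y0\<close>.  Its image under \<open>g\<close> and the curve
        produced by \<open>\<Phi>\<close> are integral curves of \<open>Z\<close> with the same initial value.\<close>
      obtain E f where f: "maximal_flow X E f"
        using Z(2) unfolding is_action_def by blast
      define y where "y = (\<lambda>t. f t y0)"
      have y: "integral_curve X {t. (t, y0) \<in> E} y" and y_0: "y 0 = y0"
        using f generalized_flow_curve[of X E f y0] by (auto simp: maximal_flow_def y_def)
      obtain \<delta> where \<delta>: "\<delta> > 0" "\<And>a. a < m \<Longrightarrow> integral_curve Z {-\<delta><..<\<delta>} (\<lambda>t. g t (x a t))"
          "integral_curve Z {-\<delta><..<\<delta>} (\<lambda>t. g t (y t))"
          "\<And>t. \<bar>t\<bar> < \<delta> \<Longrightarrow> (t, y0) \<in> E" "\<And>t. \<bar>t\<bar> < \<delta> \<Longrightarrow> (t, y t) \<in> D"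
          "\<And>t a. \<bar>t\<bar> < \<delta> \<Longrightarrow> a < m \<Longrightarrow> (t, x a t) \<in> D"
        using push[OF y] by blast
      obtain \<epsilon> where \<epsilon>: "\<epsilon> > 0" "\<And>t. \<bar>t\<bar> < \<epsilon> \<Longrightarrow> (tuple m (\<lambda>a. g t (x a t)), k) \<in> U"
          "integral_curve Z {-\<epsilon><..<\<epsilon>} (\<lambda>t. \<Phi> (tuple m (\<lambda>a. g t (x a t)), k))"
        using \<Phi>2[where \<xi> = "\<lambda>a t. g t (x a t)", OF \<delta>(2), of k] U0 N0 by (auto simp: g0 y0_def)
      have Z_smooth: "td_vector_field Z"
        using Z(1) by (simp add: td_fields_def)
      obtain d where d: "d > 0" "d \<le> \<epsilon>" "d \<le> \<delta>"
        using \<epsilon>(1) \<delta>(1) by (intro that[of "min \<epsilon> \<delta>"]) auto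
      have eq: "\<Phi> (tuple m (\<lambda>a. g t (x a t)), k) = g t (y t)" if "\<bar>t\<bar> < d" for t
        by (rule integral_curve_unique[where \<gamma> = "\<lambda>t. \<Phi> (tuple m (\<lambda>a. g t (x a t)), k)"
              and \<delta> = "\<lambda>t. g t (y t)", OF Z_smooth \<epsilon>(3) \<delta>(3)])
          (use that d in \<open>auto simp: g0 y_0 y0_def\<close>)
      have trans: "(t, tuple m (\<lambda>a. x a t), k) \<in> ?U \<and> ?\<Phi> (t, tuple m (\<lambda>a. x a t), k) = y t"
        if "\<bar>t\<bar> < d" for t
        using transfer[of t "\<lambda>a. x a t" k "y t"] that d \<epsilon>(2) \<delta>(5,6) eq[OF that] by auto
      have "integral_curve X {-d<..<d} y"
        using \<delta>(4) d by (intro integral_curve_subset[OF y]) (auto simp: is_interval_oo)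
      then have "integral_curve X {-d<..<d} (\<lambda>t. ?\<Phi> (t, tuple m (\<lambda>a. x a t), k))"
        by (rule integral_curve_cong) (use trans in auto)
      then show "\<exists>\<epsilon>>0. (\<forall>t. \<bar>t\<bar> < \<epsilon> \<longrightarrow> (t, tuple m (\<lambda>a. x a t), k) \<in> ?U) \<and>
          integral_curve X {-\<epsilon><..<\<epsilon>} (\<lambda>t. ?\<Phi> (t, tuple m (\<lambda>a. x a t), k))"
        using trans d(1) by (intro exI[of _ d]) auto
    qed
  qed
  show ?thesis
    unfolding superposition_function_def
  proof (intro conjI)
    show "open ?U" "smooth_on ?U ?\<Phi>"
      using transformed_superposition_smooth[OF Y g] \<Phi> by blast+
    show "open N" "\<forall>x0. \<exists>p. (tuple m p, x0) \<in> N"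
      using \<Phi> by blast+
  qed (rule ballI, rule allI, rule allI, rule impI, rule main, blast+)
qed

theorem proposition14:
  fixes W V V0 :: "(real ^ 'n::finite \<Rightarrow> real ^ 'n) set"
    and D :: "(real \<times> (real ^ 'n)) set"
    and g :: "real \<Rightarrow> real ^ 'n \<Rightarrow> real ^ 'n"
  assumes "quasi_lie_scheme W V"
    and "(D, g) \<in> flow_group W"
    and "lie_algebra V0" and "V0 \<subseteq> V"
  shows "(Lie_theorem TYPE('n) \<longrightarrow> lie_family (scheme_family V V0 D g)) \<and>
    (\<forall>m N U \<Phi>. associated_superposition_function V0 m N U \<Phi> \<longrightarrow>
       superposition_function (scheme_family V V0 D g) m N
         (transformed_domain m D g U \<Phi>) (transformed_superposition m D g \<Phi>))"
proof -
  obtain Y where "td_vector_field Y" "generalized_flow Y D g"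
    using assms(2) by (auto simp: flow_group_def td_fields_def)
  then have *: "superposition_function (scheme_family V V0 D g) m N
      (transformed_domain m D g U \<Phi>) (transformed_superposition m D g \<Phi>)"
    if "associated_superposition_function V0 m N U \<Phi>" for m N U \<Phi>
    using that by (rule transformed_superposition_function)
  moreover have "lie_family (scheme_family V V0 D g)" if "Lie_theorem TYPE('n)"
    using that assms(3) * unfolding Lie_theorem_def lie_family_def by blast
  ultimately show ?thesis by blast
qed

end
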